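(* Let $q\in\mathbb{C}[z]$ be a monic polynomial of degree $d\geq 1$ and let $n$ be a nonnegative integer. (a) $S_{q,n}(f)=\mathrm{Sym}_n(T_{q,n}(f))$ for all $f\in\mathbb{C}[z]_n$. (b) $\deg(T_{q,n}(f))=\deg(f)$ for all $f\in\mathbb{C}[z]_n$. (c) For $k=0,\dots,n$, the leading coefficient of $T_{q,n}(z^k)$ is $$(-1)^{k(d+1)}\binom{n}{k}\Big/\binom{nd}{kd}.$$ These leading coefficients are exactly the eigenvalues of $T_{q,n}$. (d) The linear operator $T_{q,n}\colon\mathbb{C}[z]_n\to\mathbb{C}[z]_n$ is invertible.
   Context: $\mathbb{C}[z]_m$ is the space of complex polynomials of degree at most $m$. For $f=\sum_{k=0}^m a_kz^k$, $g=\sum_{k=0}^m b_kz^k$ in $\mathbb{C}[z]_m$, the Fischer inner product is $\langle f,g\rangle_m=\sum_{k=0}^m\frac{1}{\binom{m}{k}}a_k\overline{b_k}$. For $f=\sum_{k=0}^m a_kz^k$ regarded as an element of $\mathbb{C}[z]_m$, put $f^\vee(z)=f(-z)$, $f^\#(z)=z^m\overline{f(1/\overline{z})}=\sum_{k=0}^m\overline{a_{m-k}}z^k$ (this depends on $m$), and $f^{\#\vee}=(f^\#)^\vee$. The symmetrization of $f=\sum_{k=0}^n a_kz^k\in\mathbb{C}[z]_n$ in degree $n$ is $\mathrm{Sym}_n(f)(y_1,\dots,y_n)=\sum_{k=0}^n\frac{a_k}{\binom{n}{k}}\sigma_k(y_1,\dots,y_n)$, with $\sigma_k$ the $k$-th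 elementary symmetric polynomial. For $q$ monic of degree $d$ and $f\in\mathbb{C}[z]_n$, define $$S_{q,n}(f)(u_1,\dots,u_n)=\Bigl\langle f\circ q,\ \prod_{j=1}^n(q-u_j)^{\#\vee}\Bigr\rangle_{nd},\qquad T_{q,n}(f)(z)=S_{q,n}(f)(z,\dots,z),$$ where each $q-u_j$ is regarded as an element of $\mathbb{C}[z]_d$ when forming $(q-u_j)^{\#\vee}$. *)

theory Defs
  imports Complex_Main "HOL-Computational_Algebra.Polynomial"
begin

definition poly_space :: "nat \<Rightarrow> complex poly set"
  where "poly_space m = {f. degree f \<le> m}"

definition fischer :: "nat \<Rightarrow> complex poly \<Rightarrow> complex poly \<Rightarrow> complex"
  where "fischer m f g = (\<Sum>k\<le>m. 1 / of_nat (m choose k) * coeff f k * cnj (coeff g k))"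

definition vee :: "complex poly \<Rightarrow> complex poly"
  where "vee f = pcompose f [:0, -1:]"

definition hash :: "nat \<Rightarrow> complex poly \<Rightarrow> complex poly"
  where "hash m f = (\<Sum>k\<le>m. monom (cnj (coeff f (m - k))) k)"

(* The variables y_1, ..., y_n are the values y 1, ..., y n of a function on nat;
   other values of y are irrelevant. *)

definition elem_sym :: "nat \<Rightarrow> nat \<Rightarrow> (nat \<Rightarrow> complex) \<Rightarrow> complex"
  where "elem_sym n k y = (\<Sum>A | A \<subseteq> {1..n} \<and> card A = k. \<Prod>i\<in>A. y i)"

definition symmetrization :: "nat \<Rightarrow> complex poly \<Rightarrow> (nat \<Rightarrow> complex) \<Rightarrow> complex"
  where "symmetrization n f y = (\<Sum>k\<le>n. coeff f k / of_nat (n choose k) * elem_sym n k y)"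

definition S_op :: "complex poly \<Rightarrow> nat \<Rightarrow> complex poly \<Rightarrow> (nat \<Rightarrow> complex) \<Rightarrow> complex"
  where "S_op q n f u =
    fischer (n * degree q) (pcompose f q) (\<Prod>j=1..n. vee (hash (degree q) (q - [:u j:])))"

(* The polynomial representing the function z \<mapsto> S_op q n f (z, ..., z); it exists and is
   unique by the lemma poly_T_op below. *)
definition T_op :: "complex poly \<Rightarrow> nat \<Rightarrow> complex poly \<Rightarrow> complex poly"
  where "T_op q n f = (THE p. \<forall>z. poly p z = S_op q n f (\<lambda>_. z))"

definition linear_operator_on :: "complex poly set \<Rightarrow> (complex poly \<Rightarrow> complex poly) \<Rightarrow> bool"
  where "linear_operator_on V L \<longleftrightarrow> L ` V \<subseteq> V \<and>
    (\<forall>f\<in>V. \<forall>g\<in>V. L (f + g) = L f + L g) \<and> (\<forall>c. \<forall>f\<in>V. L (smult c f) = smult c (L f))"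

definition eigenvalues_on :: "complex poly set \<Rightarrow> (complex poly \<Rightarrow> complex poly) \<Rightarrow> complex set"
  where "eigenvalues_on V L = {c. \<exists>f\<in>V. f \<noteq> 0 \<and> L f = smult c f}"

lemma coeff_hash: "coeff (hash m f) k = (if k \<le> m then cnj (coeff f (m - k)) else 0)"
  by (simp add: hash_def coeff_sum)

lemma coeff_vee: "coeff (vee f) k = (-1) ^ k * coeff f k"
  by (simp add: vee_def coeff_pcompose_linear)

definition conj_poly_coeffs :: "(complex \<Rightarrow> complex poly) \<Rightarrow> bool"
  where "conj_poly_coeffs F \<longleftrightarrow> (\<forall>k. \<exists>p. \<forall>z. cnj (coeff (F z) k) = poly p z)"

lemma conj_poly_coeffs_mult:
  assumes "conj_poly_coeffs F" "conj_poly_coeffs G"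
  shows "conj_poly_coeffs (\<lambda>z. F z * G z)"
proof -
  obtain p r where p: "\<And>k z. cnj (coeff (F z) k) = poly (p k) z"
    and r: "\<And>k z. cnj (coeff (G z) k) = poly (r k) z"
    using assms unfolding conj_poly_coeffs_def by metis
  have "cnj (coeff (F z * G z) k) = poly (\<Sum>i\<le>k. p i * r (k - i)) z" for k z
    by (simp add: coeff_mult poly_sum p r)
  then show ?thesis
    unfolding conj_poly_coeffs_def by blast
qed

lemma conj_poly_coeffs_factor: "conj_poly_coeffs (\<lambda>z. vee (hash m (q - [:z:])))"
  unfolding conj_poly_coeffs_def
proof
  fix k
  let ?p = "if k \<le> m then smult ((-1) ^ k) ([:coeff q (m - k):] - (if m - k = 0 then [:0, 1:] else 0)) else 0"
  have "\<forall>z. cnj (coeff (vee (hash m (q - [:z:]))) k) = poly ?p z"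
    by (auto simp: coeff_vee coeff_hash coeff_pCons split: nat.split)
  then show "\<exists>p. \<forall>z. cnj (coeff (vee (hash m (q - [:z:]))) k) = poly p z"
    by blast
qed

lemma conj_poly_coeffs_power: "conj_poly_coeffs F \<Longrightarrow> conj_poly_coeffs (\<lambda>z. F z ^ n)"
proof (induction n)
  case 0
  have "\<forall>z. cnj (coeff 1 k) = poly [:cnj (coeff 1 k):] z" for k
    by simp
  then show ?case
    unfolding conj_poly_coeffs_def power_0 by blast
next
  case (Suc n)
  then show ?case
    by (simp add: conj_poly_coeffs_mult)
qed

lemma ex_T_op: "\<exists>p. \<forall>z. poly p z = S_op q n f (\<lambda>_. z)"
proof -
  have "conj_poly_coeffs (\<lambda>z. vee (hash (degree q) (q - [:z:])) ^ n)"
    by (intro conj_poly_coeffs_power conj_poly_coeffs_factor)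
  then obtain p where
    p: "\<And>k z. cnj (coeff (vee (hash (degree q) (q - [:z:])) ^ n) k) = poly (p k) z"
    unfolding conj_poly_coeffs_def by metis
  let ?m = "n * degree q"
  have "poly (\<Sum>k\<le>?m. smult (1 / of_nat (?m choose k) * coeff (pcompose f q) k) (p k)) z
      = S_op q n f (\<lambda>_. z)" for z
    unfolding S_op_def fischer_def by (simp add: poly_sum p)
  then show ?thesis
    by blast
qed

lemma poly_T_op: "poly (T_op q n f) z = S_op q n f (\<lambda>_. z)"
proof -
  have "\<exists>!p. \<forall>z. poly p z = S_op q n f (\<lambda>_. z)"
  proof (rule ex_ex1I[OF ex_T_op])
    fix p r
    assume "\<forall>z. poly p z = S_op q n f (\<lambda>_. z)" "\<forall>z. poly r z = S_op q n f (\<lambda>_. z)"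
    then have "poly p = poly r"
      by auto
    then show "p = r"
      by (simp add: poly_eq_poly_eq_iff)
  qed
  from theI'[OF this] show ?thesis
    unfolding T_op_def by blast
qed

end

theory Submission
  imports Defs
begin

text \<open>
  With \<open>P = q\<^sup>#\<^sup>\<or>\<close> one has \<open>(q - u)\<^sup>#\<^sup>\<or> = P + cnj u M\<close> for the monomial
  \<open>M = (-1)\<^bsup>d+1\<^esup> z\<^sup>d\<close>, so expanding the product gives
  \<open>S(f)(u) = (\<Sum>k. c\<^sub>k(f) \<sigma>\<^sub>k(u))\<close> with \<open>c\<^sub>k(f) = \<langle>f \<circ> q, M\<^sup>k P\<^bsup>n-k\<^esup>\<rangle>\<close>. This yields (a) and
  shows that the coefficients of \<open>T(f)\<close> are \<open>(n choose k) c\<^sub>k(f)\<close>. As \<open>f \<circ> q\<close> has degree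
  \<open>d deg f\<close> while \<open>M\<^sup>k P\<^bsup>n-k\<^esup>\<close> is divisible by \<open>z\<^bsup>kd\<^esup>\<close>, \<open>c\<^sub>k(f)\<close> vanishes for \<open>k > deg f\<close> and only
  one term of the Fischer product survives for \<open>k = deg f\<close>. Hence \<open>T\<close> is triangular with
  nonzero diagonal.
\<close>

section \<open>Expansion in elementary symmetric polynomials\<close>

lemma fischer_sum_right: "fischer m f (\<Sum>a\<in>A. g a) = (\<Sum>a\<in>A. fischer m f (g a))"
  unfolding fischer_def by (simp add: coeff_sum sum_distrib_left) (rule sum.swap)

lemma fischer_smult_right: "fischer m f (smult c g) = cnj c * fischer m f g"
  unfolding fischer_def by (simp add: sum_distrib_left mult_ac)

lemma fischer_add_left: "fischer m (f + g) h = fischer m f h + fischer m g h"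
  unfolding fischer_def by (simp add: sum.distrib[symmetric] algebra_simps add_divide_distrib)

lemma fischer_smult_left: "fischer m (smult c f) h = c * fischer m f h"
  unfolding fischer_def by (simp add: sum_distrib_left mult_ac)

text \<open>The constant term of \<open>q - [:u:]\<close> is moved by \<open>hash\<close> to index
  \<open>m\<close>, where the term \<open>-u\<close> becomes \<open>- cnj u\<close>;
  \<open>vee\<close> then multiplies by \<open>(-1) ^ m\<close>, so the sign is
  \<open>(-1) ^ (m + 1)\<close>.\<close>

lemma vee_hash_diff_const:
  "vee (hash m (q - [:u:])) = vee (hash m q) + smult (cnj u) (monom ((-1) ^ (m + 1)) m)"
  by (rule poly_eqI)
    (auto simp: coeff_vee coeff_hash coeff_pCons algebra_simps split: nat.split)

text \<open>The set \<open>A\<close> collects the factors from which the multiple of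
  \<open>r\<close> is chosen.\<close>

lemma prod_add_smult:
  fixes p r :: "'a::comm_ring_1 poly" and c :: "'b \<Rightarrow> 'a"
  assumes "finite I"
  shows "(\<Prod>i\<in>I. p + smult (c i) r) =
    (\<Sum>A\<in>Pow I. smult (\<Prod>i\<in>A. c i) (r ^ card A * p ^ (card I - card A)))"
proof -
  have "(\<Prod>i\<in>I. smult (c i) r + p) = (\<Sum>A\<in>Pow I. (\<Prod>i\<in>A. smult (c i) r) * (\<Prod>i\<in>I - A. p))"
    by (rule prod_add[OF assms])
  also have "\<dots> = (\<Sum>A\<in>Pow I. smult (\<Prod>i\<in>A. c i) (r ^ card A * p ^ (card I - card A)))"
    using assms
    by (intro sum.cong) (auto simp: prod_smult card_Diff_subset finite_subset)
  finally show ?thesis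
    by (simp add: add.commute)
qed

definition S_coeff :: "complex poly \<Rightarrow> nat \<Rightarrow> complex poly \<Rightarrow> nat \<Rightarrow> complex"
  where "S_coeff q n f k = fischer (n * degree q) (pcompose f q)
    (monom ((-1) ^ (degree q + 1)) (degree q) ^ k * vee (hash (degree q) q) ^ (n - k))"

lemma S_op_elem_sym: "S_op q n f u = (\<Sum>k\<le>n. S_coeff q n f k * elem_sym n k u)"
proof -
  let ?I = "{1..n}"
  \<comment> \<open>The Fischer product is conjugate linear on the right, so each
    \<open>cnj (u i)\<close> from the factors comes out as \<open>u i\<close>. What remains depends
    on \<open>A\<close> only through its cardinality.\<close>
  have "S_op q n f u = (\<Sum>A\<in>Pow ?I. (\<Prod>i\<in>A. u i) * S_coeff q n f (card A))"
    unfolding S_op_def vee_hash_diff_const S_coeff_def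
    by (simp add: prod_add_smult fischer_sum_right fischer_smult_right)
  also have "\<dots> = (\<Sum>k\<le>n. \<Sum>A | A \<in> Pow ?I \<and> card A = k. (\<Prod>i\<in>A. u i) * S_coeff q n f (card A))"
    using card_mono[of ?I] by (intro sum.group[symmetric]) auto
  also have "\<dots> = (\<Sum>k\<le>n. S_coeff q n f k * elem_sym n k u)"
    by (simp add: elem_sym_def sum_distrib_left mult.commute)
  finally show ?thesis .
qed

lemma elem_sym_const: "elem_sym n k (\<lambda>_. z) = of_nat (n choose k) * z ^ k"
  unfolding elem_sym_def using n_subsets[of "{1..n}" k] by simp

lemma T_op_eq: "T_op q n f = (\<Sum>k\<le>n. monom (of_nat (n choose k) * S_coeff q n f k) k)"
proof -
  have "poly (T_op q n f) z = poly (\<Sum>k\<le>n. monom (of_nat (n choose k) * S_coeff q n f k) k) z" for z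
    by (simp add: poly_T_op S_op_elem_sym elem_sym_const poly_sum poly_monom mult_ac)
  then show ?thesis
    by (simp add: poly_eq_poly_eq_iff[symmetric] fun_eq_iff)
qed

lemma coeff_T_op:
  "coeff (T_op q n f) k = (if k \<le> n then of_nat (n choose k) * S_coeff q n f k else 0)"
  by (simp add: T_op_eq coeff_sum)

text \<open>Setting all variables equal turns the k-th elementary symmetric polynomial into
  \<open>n choose k\<close> copies of \<open>z ^ k\<close>, and \<open>symmetrization\<close>
  divides by the same binomial coefficient.\<close>

lemma S_op_eq_symmetrization: "S_op q n f = symmetrization n (T_op q n f)"
  by (rule ext) (simp add: symmetrization_def coeff_T_op S_op_elem_sym)

lemma T_op_add: "T_op q n (f + g) = T_op q n f + T_op q n g"
  by (rule poly_eqI)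
    (simp add: coeff_T_op S_coeff_def pcompose_add fischer_add_left algebra_simps)

lemma T_op_smult: "T_op q n (smult c f) = smult c (T_op q n f)"
  by (rule poly_eqI)
    (simp add: coeff_T_op S_coeff_def pcompose_smult fischer_smult_left)

section \<open>Diagonal entries and degrees\<close>

definition T_diag :: "nat \<Rightarrow> nat \<Rightarrow> nat \<Rightarrow> complex"
  where "T_diag d n k =
    (-1) ^ (k * (d + 1)) * of_nat (n choose k) / of_nat ((n * d) choose (k * d))"

lemma T_diag_nonzero: "k \<le> n \<Longrightarrow> T_diag d n k \<noteq> 0"
  by (simp add: T_diag_def)

lemma coeff_monom_power_mult:
  "coeff (monom c d ^ k * p) m = (if m < k * d then 0 else c ^ k * coeff p (m - k * d))"
  by (simp add: monom_power coeff_monom_mult mult.commute[of d k])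

lemma S_coeff_eq_0:
  assumes "degree q \<ge> 1" "degree f < k"
  shows "S_coeff q n f k = 0"
proof -
  have "coeff (pcompose f q) m = 0" if "m \<ge> k * degree q" for m
  proof (rule coeff_eq_0)
    have "degree f * degree q < k * degree q"
      using assms by simp
    with that show "degree (pcompose f q) < m"
      unfolding degree_pcompose by linarith
  qed
  then show ?thesis
    unfolding S_coeff_def fischer_def by (intro sum.neutral) (auto simp: coeff_monom_power_mult)
qed

lemma S_coeff_degree:
  assumes "lead_coeff q = 1" "degree q \<ge> 1" "degree f \<le> n"
  shows "S_coeff q n f (degree f) = (-1) ^ (degree f * (degree q + 1)) * lead_coeff f
    / of_nat ((n * degree q) choose (degree f * degree q))"
proof -
  let ?d = "degree q" and ?k = "degree f"
  let ?M = "monom ((-1) ^ (?d + 1)) ?d :: complex poly" and ?P = "vee (hash ?d q)"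
  define t where
    "t m = 1 / of_nat (n * ?d choose m) * coeff (pcompose f q) m * cnj (coeff (?M ^ ?k * ?P ^ (n - ?k)) m)"
    for m
  have zero: "t m = 0" if "m \<noteq> ?k * ?d" for m
  proof (cases "m < ?k * ?d")
    case True
    then show ?thesis by (simp add: t_def coeff_monom_power_mult)
  next
    case False
    with that have "coeff (pcompose f q) m = 0"
      by (intro coeff_eq_0) (simp add: degree_pcompose)
    then show ?thesis by (simp add: t_def)
  qed
  \<comment> \<open>The leading coefficient of the monic \<open>q\<close> becomes the constant term
    of \<open>?P\<close>.\<close>
  have P: "coeff (?P ^ (n - ?k)) 0 = 1"
    using assms(1) by (simp add: coeff_0_power coeff_vee coeff_hash)
  have M: "coeff (?M ^ ?k * ?P ^ (n - ?k)) (?k * ?d) = (-1) ^ (?k * (?d + 1))"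
    unfolding coeff_monom_power_mult
    by (simp only: less_irrefl if_False diff_self_eq_0 P power_mult[symmetric] mult_1_right
        mult.commute[of ?k])
  have L: "coeff (pcompose f q) (?k * ?d) = lead_coeff f"
    using lead_coeff_comp[of q f] assms by (simp add: degree_pcompose)
  have "S_coeff q n f ?k = (\<Sum>m\<le>n * ?d. t m)"
    by (simp add: S_coeff_def fischer_def t_def)
  also have "\<dots> = (\<Sum>m\<in>{?k * ?d}. t m)"
    using assms(3) zero by (intro sum.mono_neutral_right) auto
  also have "\<dots> = (-1) ^ (?k * (?d + 1)) * lead_coeff f / of_nat (n * ?d choose (?k * ?d))"
    using M by (simp add: t_def L)
  finally show ?thesis .
qed

lemma coeff_T_op_eq_0:
  assumes "degree q \<ge> 1" "degree f < k"
  shows "coeff (T_op q n f) k = 0"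
  using assms by (simp add: coeff_T_op S_coeff_eq_0)

lemma coeff_T_op_degree:
  assumes "lead_coeff q = 1" "degree q \<ge> 1" "degree f \<le> n"
  shows "coeff (T_op q n f) (degree f) = T_diag (degree q) n (degree f) * lead_coeff f"
  using assms by (simp add: coeff_T_op S_coeff_degree T_diag_def)

text \<open>Equality of degrees does not separate 0 from the nonzero constants, since
  \<open>degree 0 = 0\<close>; this trivial kernel does, and it later gives injectivity.\<close>

lemma T_op_eq_0_iff:
  assumes "lead_coeff q = 1" "degree q \<ge> 1" "degree f \<le> n"
  shows "T_op q n f = 0 \<longleftrightarrow> f = 0"
proof
  assume "T_op q n f = 0"
  then show "f = 0"
    using coeff_T_op_degree[OF assms] T_diag_nonzero[OF assms(3)] by simp
next
  assume "f = 0"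
  then show "T_op q n f = 0"
    using T_op_smult[of q n 0 0] by simp
qed

lemma degree_T_op:
  assumes "lead_coeff q = 1" "degree q \<ge> 1" "degree f \<le> n"
  shows "degree (T_op q n f) = degree f"
proof (cases "f = 0")
  case True
  then show ?thesis using T_op_eq_0_iff[OF assms] by simp
next
  case False
  then have "coeff (T_op q n f) (degree f) \<noteq> 0"
    using coeff_T_op_degree[OF assms] T_diag_nonzero[OF assms(3)] by simp
  moreover have "degree (T_op q n f) \<le> degree f"
    using coeff_T_op_eq_0[OF assms(2)] by (intro degree_le) auto
  ultimately show ?thesis
    by (simp add: le_degree le_antisym)
qed

section \<open>Triangular operators on polynomials\<close>

text \<open>Back substitution: a multiple of \<open>L (monom 1 m)\<close> cancels the top
  coefficient of \<open>g\<close>, and induction handles the rest. The bound is exclusive, so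
  \<open>m = 0\<close> stands for the zero space.\<close>

lemma triangular_surj:
  fixes L :: "'a::field poly \<Rightarrow> 'a poly"
  assumes add: "\<And>f g. L (f + g) = L f + L g" and smult: "\<And>c f. L (smult c f) = smult c (L f)"
    and upper: "\<And>j i. j < m \<Longrightarrow> j < i \<Longrightarrow> coeff (L (monom 1 j)) i = 0"
    and diag: "\<And>j. j < m \<Longrightarrow> coeff (L (monom 1 j)) j \<noteq> 0"
    and g: "\<And>i. m \<le> i \<Longrightarrow> coeff g i = 0"
  shows "\<exists>f. (\<forall>i\<ge>m. coeff f i = 0) \<and> L f = g"
  using upper diag g
proof (induction m arbitrary: g)
  case 0
  then have "g = 0"
    by (intro poly_eqI) simp
  moreover have "L 0 = 0"
    using smult[of 0 0] by simp
  ultimately show ?case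
    by (intro exI[of _ 0]) simp
next
  case (Suc m)
  define a where "a = coeff g m / coeff (L (monom 1 m)) m"
  define h where "h = g - smult a (L (monom 1 m))"
  have "coeff h i = 0" if "m \<le> i" for i
  proof (cases "i = m")
    case True
    then show ?thesis using Suc.prems(2)[of m] by (simp add: h_def a_def)
  next
    case False
    then show ?thesis using that Suc.prems(1)[of m i] Suc.prems(3)[of i] by (simp add: h_def)
  qed
  with Suc.IH[of h] Suc.prems obtain f where f: "\<forall>i\<ge>m. coeff f i = 0" "L f = h"
    by auto
  have "L (f + smult a (monom 1 m)) = g"
    by (simp add: add smult f h_def del: smult_monom)
  moreover have "\<forall>i\<ge>Suc m. coeff (f + smult a (monom 1 m)) i = 0"
    using f by simp
  ultimately show ?case
    by blast
qed

text \<open>The diagonal entries need not be distinct, hence the choice of the least index carrying the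
  given value: below it the operator minus that value is invertible.\<close>

lemma triangular_eigenvector:
  fixes L :: "'a::field poly \<Rightarrow> 'a poly"
  assumes add: "\<And>f g. L (f + g) = L f + L g" and smult: "\<And>c f. L (smult c f) = smult c (L f)"
    and upper: "\<And>j i. j \<le> m \<Longrightarrow> j < i \<Longrightarrow> coeff (L (monom 1 j)) i = 0"
  shows "\<exists>f. degree f \<le> m \<and> f \<noteq> 0 \<and> L f = smult (coeff (L (monom 1 m)) m) f"
proof -
  define c where "c = coeff (L (monom 1 m)) m"
  define k where "k = (LEAST j. coeff (L (monom 1 j)) j = c)"
  have k: "coeff (L (monom 1 k)) k = c"
    unfolding k_def by (rule LeastI[of _ m]) (simp add: c_def)
  have km: "k \<le> m"
    unfolding k_def by (rule Least_le) (simp add: c_def)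
  have less: "coeff (L (monom 1 j)) j \<noteq> c" if "j < k" for j
    using not_less_Least that unfolding k_def by blast
  define K where "K f = L f - smult c f" for f
  \<comment> \<open>The entry of \<open>K\<close> at \<open>k\<close> is 0, so
    \<open>K (monom 1 k)\<close> has only coefficients below \<open>k\<close>, where all diagonal
    entries of \<open>K\<close> are nonzero.\<close>
  have "\<exists>f. (\<forall>i\<ge>k. coeff f i = 0) \<and> K f = K (monom 1 k)"
  proof (rule triangular_surj)
    fix i assume "k \<le> i"
    then show "coeff (K (monom 1 k)) i = 0"
      using k km upper[of k i] by (cases "i = k") (auto simp: K_def)
  qed (use less km upper in \<open>auto simp: K_def add smult algebra_simps smult_add_right smult_diff_right\<close>)
  then obtain f where f: "\<forall>i\<ge>k. coeff f i = 0" "K f = K (monom 1 k)"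
    by blast
  \<comment> \<open>A kernel vector of \<open>K\<close>, with coefficient 1 at \<open>k\<close>
    because \<open>f\<close> has none there.\<close>
  define v where "v = monom 1 k + smult (-1) f"
  have "coeff v k \<noteq> 0"
    using f by (simp add: v_def)
  moreover have "degree v \<le> m"
    using f km by (intro degree_le) (auto simp: v_def)
  moreover have "L v = smult c v"
  proof -
    have "L v = L (monom 1 k) - L f"
      unfolding v_def add smult by simp
    also have "\<dots> = smult c (monom 1 k) - smult c f"
      using f(2) by (simp add: K_def algebra_simps)
    also have "\<dots> = smult c v"
      by (simp add: v_def smult_diff_right)
    finally show ?thesis .
  qed
  ultimately show ?thesis
    unfolding c_def by (intro exI[of _ v]) auto
qed

theorem proposition3p1:
  fixes q :: "complex poly" and d n :: nat
  assumes "lead_coeff q = 1" and "degree q = d" and "d \<ge> 1"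
  shows "(\<forall>f\<in>poly_space n. S_op q n f = symmetrization n (T_op q n f)) \<and>
    (\<forall>f\<in>poly_space n. degree (T_op q n f) = degree f \<and> (T_op q n f = 0 \<longleftrightarrow> f = 0)) \<and>
    (\<forall>k\<le>n. lead_coeff (T_op q n (monom 1 k)) =
        (-1) ^ (k * (d + 1)) * of_nat (n choose k) / of_nat ((n * d) choose (k * d))) \<and>
    eigenvalues_on (poly_space n) (T_op q n) =
        (\<lambda>k. lead_coeff (T_op q n (monom 1 k))) ` {0..n} \<and>
    linear_operator_on (poly_space n) (T_op q n) \<and>
    bij_betw (T_op q n) (poly_space n) (poly_space n)"
proof -
  let ?V = "poly_space n" and ?T = "T_op q n"
  have deg: "degree q \<ge> 1"
    using assms by simp
  note T = degree_T_op[OF assms(1) deg] T_op_eq_0_iff[OF assms(1) deg]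
    coeff_T_op_degree[OF assms(1) deg, unfolded assms(2)]
  have lead: "lead_coeff (?T (monom 1 k)) = T_diag d n k" if "k \<le> n" for k
    using that T(1)[of "monom 1 k"] T(3)[of "monom 1 k"] by (simp add: degree_monom_eq)
  have upper: "coeff (?T (monom 1 j)) i = 0" if "j < i" for i j
    using that by (intro coeff_T_op_eq_0[OF deg]) (simp add: degree_monom_eq)
  have diag: "coeff (?T (monom 1 k)) k = T_diag d n k" if "k \<le> n" for k
    using that T(3)[of "monom 1 k"] by (simp add: degree_monom_eq)
  have into: "?T ` ?V \<subseteq> ?V"
    using T(1) by (auto simp: poly_space_def)
  have "eigenvalues_on ?V ?T = T_diag d n ` {0..n}"
  proof (intro equalityI subsetI)
    fix c assume "c \<in> eigenvalues_on ?V ?T"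
    then obtain f where f: "degree f \<le> n" "f \<noteq> 0" "?T f = smult c f"
      by (auto simp: eigenvalues_on_def poly_space_def)
    \<comment> \<open>Compare the coefficients at \<open>degree f\<close>.\<close>
    then have "c = T_diag d n (degree f)"
      using T(3)[OF f(1)] by simp
    with f show "c \<in> T_diag d n ` {0..n}"
      by simp
  next
    fix c assume "c \<in> T_diag d n ` {0..n}"
    then obtain k where k: "k \<le> n" "c = T_diag d n k"
      by auto
    then obtain f where "degree f \<le> k" "f \<noteq> 0" "?T f = smult c f"
      using triangular_eigenvector[of ?T k, OF T_op_add T_op_smult upper] diag by metis
    moreover from this k have "f \<in> ?V"
      by (simp add: poly_space_def)
    ultimately show "c \<in> eigenvalues_on ?V ?T"
      unfolding eigenvalues_on_def by blast
  qed
  also have "\<dots> = (\<lambda>k. lead_coeff (?T (monom 1 k))) ` {0..n}"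
    using lead by (intro image_cong) auto
  finally have eigen: "eigenvalues_on ?V ?T = (\<lambda>k. lead_coeff (?T (monom 1 k))) ` {0..n}" .
  have "bij_betw ?T ?V ?V"
    unfolding bij_betw_def
  proof
    show "inj_on ?T ?V"
    proof (rule inj_onI)
      fix f g assume fg: "f \<in> ?V" "g \<in> ?V" "?T f = ?T g"
      have "?T (f - g) = ?T f - ?T g"
        using T_op_add[of q n "f - g" g] by simp
      moreover have "degree (f - g) \<le> n"
        using fg by (simp add: poly_space_def degree_diff_le)
      ultimately show "f = g"
        using T(2)[of "f - g"] fg by simp
    qed
    have "g \<in> ?T ` ?V" if "g \<in> ?V" for g
    proof -
      \<comment> \<open>The exclusive bound \<open>Suc n\<close> describes
        \<open>poly_space n\<close>.\<close>
      have "\<exists>f. (\<forall>i\<ge>Suc n. coeff f i = 0) \<and> ?T f = g"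
        using that diag T_diag_nonzero
        by (intro triangular_surj T_op_add T_op_smult upper)
          (auto simp: poly_space_def coeff_eq_0 less_Suc_eq_le)
      then obtain f where "\<forall>i\<ge>Suc n. coeff f i = 0" "?T f = g"
        by blast
      moreover from this have "f \<in> ?V"
        unfolding poly_space_def by (auto intro: degree_le)
      ultimately show ?thesis
        by blast
    qed
    with into show "?T ` ?V = ?V"
      by blast
  qed
  moreover have "linear_operator_on ?V ?T"
    using into by (simp add: linear_operator_on_def T_op_add T_op_smult)
  ultimately show ?thesis
    using eigen lead T(1,2) by (auto simp: S_op_eq_symmetrization poly_space_def T_diag_def)
qed

end
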